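(* Every matroid of rank three or of corank three satisfies $\sqrt{\mathrm{BLC}}$; that is, if $\mathcal{M}$ is a matroid on ground set $E$ whose rank is $3$ or whose dual has rank $3$, then for all $\mathbf{y}>\mathbf{0}$, all $S\subseteq E$ with $|S|=n$, and all $1\leq j\leq n-1$ with $M_j(S,\mathbf{y})\neq0$, $$M_j(S,\mathbf{y})^2>\Bigl[1+\frac{1}{\min(j,n-j)}\Bigr]M_{j-1}(S,\mathbf{y})\,M_{j+1}(S,\mathbf{y}).$$
   Context: Let $\mathcal{M}$ be a matroid on a finite ground set $E$, identified with its set of bases. Write $\mathbf{y}>\mathbf{0}$ for an assignment of positive real weights $\mathbf{y}=(y_e)_{e\in E}$, and $\mathbf{y}^A=\prod_{e\in A}y_e$. For $S\subseteq E$ and integer $j$ let $M_j(S,\mathbf{y})=\sum\mathbf{y}^B$, the sum over all bases $B$ of $\mathcal{M}$ with $|B\cap S|=j$. *)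

theory Defs
  imports Complex_Main
begin

text \<open>A matroid on the finite ground set \<open>E\<close>, given by its set of bases \<open>\<M>\<close>.\<close>

definition matroid :: "'a set \<Rightarrow> 'a set set \<Rightarrow> bool" where
  "matroid E \<M> \<longleftrightarrow>
     finite E \<and> \<M> \<subseteq> Pow E \<and> \<M> \<noteq> {} \<and>
     (\<forall>A\<in>\<M>. \<forall>B\<in>\<M>. \<forall>a\<in>A - B. \<exists>b\<in>B - A. insert b (A - {a}) \<in> \<M>)"

text \<open>The maximum is attained at every basis: see \<open>card_basis_eq_rank\<close> below.\<close>

definition matroid_rank :: "'a set set \<Rightarrow> nat" where
  "matroid_rank \<M> = Max (card ` \<M>)"

definition matroid_dual :: "'a set \<Rightarrow> 'a set set \<Rightarrow> 'a set set" where
  "matroid_dual E \<M> = (\<lambda>B. E - B) ` \<M>"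

text \<open>The polynomial \<open>M\<^sub>j(S, y)\<close>.\<close>

definition basis_sum :: "'a set set \<Rightarrow> nat \<Rightarrow> 'a set \<Rightarrow> ('a \<Rightarrow> real) \<Rightarrow> real" where
  "basis_sum \<M> j S y = (\<Sum>B | B \<in> \<M> \<and> card (B \<inter> S) = j. \<Prod>e\<in>B. y e)"

text \<open>
  No \<open>j\<close> is in range if \<open>card S = 0\<close>; otherwise none of the natural number subtractions
  truncates, and the denominator is at least 1.
\<close>

definition sqrt_BLC :: "'a set \<Rightarrow> 'a set set \<Rightarrow> bool" where
  "sqrt_BLC E \<M> \<longleftrightarrow>
     (\<forall>y S j. (\<forall>e\<in>E. y e > 0) \<longrightarrow> S \<subseteq> E \<longrightarrow> 1 \<le> j \<longrightarrow> j \<le> card S - 1 \<longrightarrow>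
        basis_sum \<M> j S y \<noteq> 0 \<longrightarrow>
        (basis_sum \<M> j S y)\<^sup>2 >
          (1 + 1 / real (min j (card S - j))) *
          basis_sum \<M> (j - 1) S y * basis_sum \<M> (j + 1) S y)"

lemma matroid_exchange:
  assumes "matroid E \<M>" "A \<in> \<M>" "B \<in> \<M>" "a \<in> A - B"
  obtains b where "b \<in> B - A" "insert b (A - {a}) \<in> \<M>"
  using assms unfolding matroid_def by meson

lemma matroid_basis:
  assumes "matroid E \<M>" "A \<in> \<M>"
  shows "A \<subseteq> E" "finite A"
proof -
  show "A \<subseteq> E" using assms by (auto simp: matroid_def)
  then show "finite A" using assms(1) finite_subset by (auto simp: matroid_def)
qed

lemma matroid_card_le:
  assumes "matroid E \<M>" "A \<in> \<M>" "B \<in> \<M>"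
  shows "card A \<le> card B"
  using assms(2)
proof (induction "card (A - B)" arbitrary: A rule: less_induct)
  case less
  have fin: "finite A" "finite B"
    using matroid_basis[OF assms(1)] assms(3) less.prems by simp_all
  show ?case
  proof (cases "A \<subseteq> B")
    case True
    then show ?thesis using fin card_mono by blast
  next
    case False
    then obtain a where a: "a \<in> A - B" by blast
    then obtain b where b: "b \<in> B - A" "insert b (A - {a}) \<in> \<M>"
      using matroid_exchange[OF assms(1) less.prems assms(3)] by metis
    have "insert b (A - {a}) - B = (A - B) - {a}" using b(1) by auto
    then have "card (insert b (A - {a}) - B) < card (A - B)"
      using fin a card_Diff1_less[of "A - B" a] by simp
    then have "card (insert b (A - {a})) \<le> card B" using less.hyps b by blast
    moreover have "card (insert b (A - {a})) = card A"
      using a b(1) fin card_Suc_Diff1[of A a] by simp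
    ultimately show ?thesis by simp
  qed
qed

lemma card_basis_eq_rank:
  assumes "matroid E \<M>" "B \<in> \<M>"
  shows "card B = matroid_rank \<M>"
proof -
  have "card A = card B" if "A \<in> \<M>" for A
    using matroid_card_le[OF assms(1)] that assms(2) by (simp add: order_antisym)
  then have "card ` \<M> = {card B}"
    using assms(2) by blast
  then show ?thesis by (simp add: matroid_rank_def)
qed

lemma matroid_dual_matroid:
  assumes M: "matroid E \<M>"
  shows "matroid E (matroid_dual E \<M>)"
proof -
  have "\<exists>b\<in>(E - B) - (E - A). insert b ((E - A) - {a}) \<in> matroid_dual E \<M>"
    if A: "A \<in> \<M>" and B: "B \<in> \<M>" and a: "a \<in> (E - A) - (E - B)" for A B a
  proof -
    have "\<exists>C\<in>\<M>. a \<in> C \<and> C \<subseteq> insert a A \<and> A \<inter> B \<subseteq> C"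
      using B a
    proof (induction "card (B - insert a A)" arbitrary: B rule: less_induct)
      case less
      show ?case
      proof (cases "B \<subseteq> insert a A")
        case True
        then show ?thesis using less.prems by blast
      next
        case False
        then obtain x where x: "x \<in> B" "x \<notin> insert a A" by blast
        then have "x \<in> B - A" by blast
        then obtain b where b: "b \<in> A - B" "insert b (B - {x}) \<in> \<M>"
          using matroid_exchange[OF M less.prems(1) A] by metis
        have fin: "finite B" using matroid_basis[OF M less.prems(1)] by simp
        have "insert b (B - {x}) - insert a A = (B - insert a A) - {x}" using b(1) by auto
        then have "card (insert b (B - {x}) - insert a A) < card (B - insert a A)"
          using fin x card_Diff1_less[of "B - insert a A" x] by simp
        moreover have "a \<in> E - A - (E - insert b (B - {x}))" using less.prems x by blast
        ultimately obtain C where "C \<in> \<M>" "a \<in> C" "C \<subseteq> insert a A" "A \<inter> insert b (B - {x}) \<subseteq> C"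
          using less.hyps[OF _ b(2)] by metis
        then show ?thesis using x by blast
      qed
    qed
    then obtain C where C: "C \<in> \<M>" "a \<in> C" "C \<subseteq> insert a A" "A \<inter> B \<subseteq> C" by blast
    have sub: "A \<subseteq> E" "finite A" "finite C"
      using matroid_basis[OF M A] matroid_basis[OF M C(1)] by simp_all
    have "card C = card A" using card_basis_eq_rank M A C by metis
    moreover have "card (C - {a}) = card C - 1" "card C > 0"
      using C sub by (auto simp: card_gt_0_iff)
    moreover have "C - {a} \<subseteq> A" using C by blast
    ultimately have "card (A - (C - {a})) = 1"
      using sub by (simp add: card_Diff_subset)
    then obtain b where b: "A - (C - {a}) = {b}" by (metis card_1_singletonE)
    have "insert b ((E - A) - {a}) = E - C" using b C sub a by blast
    moreover have "b \<in> (E - B) - (E - A)" using b C sub a by blast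
    ultimately show ?thesis using C unfolding matroid_dual_def by blast
  qed
  then have "\<forall>A\<in>matroid_dual E \<M>. \<forall>B\<in>matroid_dual E \<M>. \<forall>a\<in>A - B.
      \<exists>b\<in>B - A. insert b (A - {a}) \<in> matroid_dual E \<M>"
    by (simp add: matroid_dual_def)
  then show ?thesis using M by (auto simp: matroid_def matroid_dual_def)
qed

end

(*
  By duality it suffices to treat rank three, where the stronger Newton inequalities
  M_1^2 >= 3 M_0 M_2 and M_2^2 >= 3 M_1 M_3 hold. They follow from the Hessian of the
  basis generating polynomial having at most one positive direction. Let K p q be the
  total weight of the bases containing p and q, and w its row sums. The Markov operator
  P = K / w is self-adjoint for the weight w. Contracting r leaves the complete
  multipartite form of a rank two matroid, which satisfies a reverse Cauchy-Schwarz
  inequality; summing over r gives P <= P^2 ("trickling down"). On the complement of the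
  constants connectivity gives P <= c for some c < 1, and together with P >= -1 the bound
  improves itself from c to c / (2 - c), so that P <= 0 there. This is a reverse
  Cauchy-Schwarz inequality for K; applied to the indicator of S and the weights
  x y_e (e in S), y_e (e not in S), it reads
    (M_1^2 - 3 M_0 M_2) + (M_1 M_2 - 9 M_0 M_3) x + (M_2^2 - 3 M_1 M_3) x^2 >= 0
  for all x > 0, and the limits x -> 0 and x -> infinity give the claim.
*)
theory Submission
  imports Defs
begin

section \<open>Trickling down for a symmetric nonnegative kernel\<close>

locale nonneg_kernel =
  fixes V :: "'a set" and K :: "'a \<Rightarrow> 'a \<Rightarrow> real"
  assumes finite_V: "finite V"
    and K_sym: "\<And>p q. K p q = K q p"
    and K_nonneg: "\<And>p q. p \<in> V \<Longrightarrow> q \<in> V \<Longrightarrow> 0 \<le> K p q"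
begin

section \<open>Weighted inner product, quadratic form and averaging operator\<close>

definition w :: "'a \<Rightarrow> real" where
  "w p = (\<Sum>q\<in>V. K p q)"

definition inner :: "('a \<Rightarrow> real) \<Rightarrow> ('a \<Rightarrow> real) \<Rightarrow> real" where
  "inner u v = (\<Sum>p\<in>V. w p * u p * v p)"

definition form :: "('a \<Rightarrow> real) \<Rightarrow> ('a \<Rightarrow> real) \<Rightarrow> real" where
  "form u v = (\<Sum>p\<in>V. \<Sum>q\<in>V. K p q * u p * v q)"

definition avg :: "('a \<Rightarrow> real) \<Rightarrow> 'a \<Rightarrow> real" where
  "avg u p = (\<Sum>q\<in>V. K p q * u q) / w p"

lemma w_nonneg: "p \<in> V \<Longrightarrow> 0 \<le> w p"
  unfolding w_def by (intro sum_nonneg K_nonneg)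

lemma K_eq_0:
  assumes "w p = 0" "p \<in> V" "q \<in> V"
  shows "K p q = 0"
  using assms sum_nonneg_eq_0_iff[OF finite_V, of "K p"] K_nonneg unfolding w_def by blast

text \<open>At a point of weight zero the division in \<open>avg\<close> yields 0, and this is the
  right value: nonnegative entries with sum zero all vanish, so the row of \<open>K\<close> is zero
  as well.\<close>

lemma w_avg: "p \<in> V \<Longrightarrow> w p * avg u p = (\<Sum>q\<in>V. K p q * u q)"
  by (cases "w p = 0") (simp_all add: avg_def K_eq_0)

lemma form_sym: "form u v = form v u"
  unfolding form_def by (subst sum.swap) (simp add: K_sym mult_ac)

lemma inner_nonneg: "0 \<le> inner u u"
  unfolding inner_def by (intro sum_nonneg) (simp add: mult.assoc w_nonneg)

lemma inner_avg: "inner u (avg v) = form u v"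
proof -
  have "inner u (avg v) = (\<Sum>p\<in>V. u p * (w p * avg v p))"
    unfolding inner_def by (simp add: mult_ac)
  also have "\<dots> = form u v"
    unfolding form_def by (intro sum.cong) (simp_all add: w_avg sum_distrib_left mult_ac)
  finally show ?thesis .
qed

lemma inner_combine:
  "inner (\<lambda>p. a * u p + b * v p) (\<lambda>p. a * u p + b * v p)
    = a\<^sup>2 * inner u u + 2 * a * b * inner u v + b\<^sup>2 * inner v v"
  unfolding inner_def
  by (simp add: sum_distrib_left flip: sum.distrib) (simp add: algebra_simps power2_eq_square)

lemma form_combine:
  "form (\<lambda>p. a * u p + b * v p) (\<lambda>p. a * u p + b * v p)
    = a\<^sup>2 * form u u + 2 * a * b * form u v + b\<^sup>2 * form v v"
proof -
  have "form (\<lambda>p. a * u p + b * v p) (\<lambda>p. a * u p + b * v p)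
    = a\<^sup>2 * form u u + a * b * form u v + a * b * form v u + b\<^sup>2 * form v v"
    unfolding form_def
    by (simp add: sum_distrib_left flip: sum.distrib) (simp add: algebra_simps power2_eq_square)
  then show ?thesis by (simp add: form_sym[of v u])
qed

lemma form_one: "form (\<lambda>_. 1) u = inner (\<lambda>_. 1) u"
  unfolding form_sym[of "\<lambda>_. 1"]
  by (simp add: form_def inner_def w_def sum_distrib_left sum_distrib_right)

lemma inner_one_combine:
  "inner (\<lambda>_. 1) (\<lambda>p. a * u p + b * v p) = a * inner (\<lambda>_. 1) u + b * inner (\<lambda>_. 1) v"
  unfolding inner_def
  by (simp add: sum_distrib_left flip: sum.distrib) (simp add: algebra_simps)

lemma inner_one_avg: "inner (\<lambda>_. 1) (avg u) = inner (\<lambda>_. 1) u"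
  by (simp add: inner_avg form_one)

text \<open>Two instances matter: \<open>c = 1\<close> shows that the averaging operator is at least
  -1, and \<open>c = -1\<close> gives the Dirichlet form used for the spectral gap.\<close>

lemma energy:
  "(\<Sum>p\<in>V. \<Sum>q\<in>V. K p q * (u p + c * u q)\<^sup>2) = (1 + c\<^sup>2) * inner u u + 2 * c * form u u"
proof -
  have "(\<Sum>p\<in>V. \<Sum>q\<in>V. K p q * (u p + c * u q)\<^sup>2)
      = (\<Sum>p\<in>V. \<Sum>q\<in>V. K p q * (u p)\<^sup>2) + c\<^sup>2 * (\<Sum>p\<in>V. \<Sum>q\<in>V. K p q * (u q)\<^sup>2)
        + 2 * c * form u u"
    unfolding form_def
    by (simp add: sum_distrib_left flip: sum.distrib) (simp add: algebra_simps power2_eq_square)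
  moreover have "(\<Sum>p\<in>V. \<Sum>q\<in>V. K p q * (u p)\<^sup>2) = inner u u"
    unfolding inner_def w_def power2_eq_square mult.assoc sum_distrib_right ..
  moreover have "(\<Sum>p\<in>V. \<Sum>q\<in>V. K p q * (u q)\<^sup>2) = (\<Sum>p\<in>V. \<Sum>q\<in>V. K p q * (u p)\<^sup>2)"
    by (subst sum.swap) (simp add: K_sym)
  ultimately show ?thesis by (simp add: algebra_simps)
qed

lemma form_ge: "- inner u u \<le> form u u"
proof -
  have "0 \<le> (\<Sum>p\<in>V. \<Sum>q\<in>V. K p q * (u p + 1 * u q)\<^sup>2)"
    by (intro sum_nonneg mult_nonneg_nonneg K_nonneg) auto
  then show ?thesis by (subst (asm) energy) simp
qed

text \<open>A Poincare inequality from paths of length two. One edge of positive weight bounds the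
  squared difference of \<open>u\<close> at its ends by a multiple of the Dirichlet form, two edges
  join any two points of positive weight, and averaging over such pairs bounds the variance. Only a
  constant below 1 is required; its size is irrelevant.\<close>

lemma spectral_gap:
  assumes conn: "\<And>p q. p \<in> V \<Longrightarrow> q \<in> V \<Longrightarrow> 0 < w p \<Longrightarrow> 0 < w q \<Longrightarrow>
      \<exists>r\<in>V. 0 < K p r \<and> 0 < K r q"
    and W: "0 < inner (\<lambda>_. 1) (\<lambda>_. 1)"
  obtains a where "0 \<le> a" "a < 1"
    "\<And>u. inner (\<lambda>_. 1) u = 0 \<Longrightarrow> form u u \<le> a * inner u u"
proof -
  define W where "W = inner (\<lambda>_. 1) (\<lambda>_. 1)"
  define P where "P = (\<lambda>(p, q). K p q) ` {(p, q) \<in> V \<times> V. 0 < K p q}"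
  \<comment> \<open>Inserting 1 keeps the minimum meaningful when no entry of \<open>K\<close> is
    positive.\<close>
  define m where "m = Min (insert 1 P)"
  have "finite P"
    unfolding P_def by (intro finite_imageI finite_subset[OF _ finite_cartesian_product[OF finite_V finite_V]]) auto
  moreover have "\<forall>x\<in>P. 0 < x" by (auto simp: P_def)
  ultimately have m: "0 < m" "\<And>x. x \<in> P \<Longrightarrow> m \<le> x" by (auto simp: m_def)
  \<comment> \<open>The second argument is the constant that the path estimate produces; the first
    ensures \<open>W \<le> C\<close>, so that the resulting bound \<open>1 - W / C\<close> is
    nonnegative.\<close>
  define C where "C = max W (4 * W\<^sup>2 / m)"
  have C: "0 < C" "W \<le> C" "4 * W\<^sup>2 / m \<le> C"
    using W by (auto simp: C_def W_def)
  have "form u u \<le> (1 - W / C) * inner u u" if u: "inner (\<lambda>_. 1) u = 0" for u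
  proof -
    define D where "D = (\<Sum>p\<in>V. \<Sum>q\<in>V. K p q * (u p - u q)\<^sup>2)"
    have D: "D = 2 * (inner u u - form u u)"
      using energy[of u "-1"] by (simp add: D_def)
    have edge: "m * (u p - u q)\<^sup>2 \<le> D" if "p \<in> V" "q \<in> V" "0 < K p q" for p q
    proof -
      have "m \<le> K p q" using that by (intro m) (auto simp: P_def)
      then have "m * (u p - u q)\<^sup>2 \<le> K p q * (u p - u q)\<^sup>2" by (intro mult_right_mono) auto
      also have "\<dots> \<le> (\<Sum>q\<in>V. K p q * (u p - u q)\<^sup>2)"
        using that finite_V K_nonneg by (intro member_le_sum) auto
      also have "\<dots> \<le> D"
        unfolding D_def using that finite_V K_nonneg
        by (intro member_le_sum[where f = "\<lambda>p. \<Sum>q\<in>V. K p q * (u p - u q)\<^sup>2"] sum_nonneg) auto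
      finally show ?thesis .
    qed
    \<comment> \<open>The factors \<open>w p * w q\<close> silence the points of weight zero, about
      which \<open>conn\<close> says nothing.\<close>
    have "w p * w q * (u p - u q)\<^sup>2 \<le> w p * w q * (4 * D / m)" if pq: "p \<in> V" "q \<in> V" for p q
    proof (cases "w p = 0 \<or> w q = 0")
      case False
      then obtain r where r: "r \<in> V" "0 < K p r" "0 < K r q"
        using conn[OF pq] w_nonneg[of p] w_nonneg[of q] pq by auto
      have "m * (u p - u q)\<^sup>2 \<le> 2 * (m * (u p - u r)\<^sup>2) + 2 * (m * (u r - u q)\<^sup>2)"
      proof -
        have "(u p - u q)\<^sup>2 \<le> 2 * (u p - u r)\<^sup>2 + 2 * (u r - u q)\<^sup>2"
          using zero_le_power2[of "(u p - u r) - (u r - u q)"]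
          by (simp add: algebra_simps power2_eq_square)
        then have "m * (u p - u q)\<^sup>2 \<le> m * (2 * (u p - u r)\<^sup>2 + 2 * (u r - u q)\<^sup>2)"
          using m by simp
        then show ?thesis by (simp add: algebra_simps)
      qed
      also have "\<dots> \<le> 4 * D" using edge[of p r] edge[of r q] pq r by simp
      finally have "(u p - u q)\<^sup>2 \<le> 4 * D / m" using m by (simp add: field_simps)
      then show ?thesis using w_nonneg pq by (intro mult_left_mono) auto
    qed auto
    then have "(\<Sum>p\<in>V. \<Sum>q\<in>V. w p * w q * (u p - u q)\<^sup>2) \<le> (\<Sum>p\<in>V. \<Sum>q\<in>V. w p * w q * (4 * D / m))"
      by (intro sum_mono)
    also have "\<dots> = W\<^sup>2 * (4 * D / m)"
      unfolding sum_distrib_right[symmetric] sum_product[symmetric]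
      by (simp add: W_def inner_def power2_eq_square)
    \<comment> \<open>The usual expression of a variance through pairwise differences; the last term
      vanishes because \<open>u\<close> has mean zero.\<close>
    also have "(\<Sum>p\<in>V. \<Sum>q\<in>V. w p * w q * (u p - u q)\<^sup>2) = 2 * W * inner u u - 2 * (inner (\<lambda>_. 1) u)\<^sup>2"
    proof -
      have "(\<Sum>p\<in>V. \<Sum>q\<in>V. w p * w q * (u p - u q)\<^sup>2)
          = (\<Sum>p\<in>V. \<Sum>q\<in>V. (w p * u p * u p) * w q) + (\<Sum>p\<in>V. \<Sum>q\<in>V. w p * (w q * u q * u q))
            - 2 * (\<Sum>p\<in>V. \<Sum>q\<in>V. (w p * u p) * (w q * u q))"
        by (simp add: sum_distrib_left flip: sum.distrib sum_subtractf)
           (simp add: algebra_simps power2_eq_square)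
      also have "\<dots> = 2 * W * inner u u - 2 * (inner (\<lambda>_. 1) u)\<^sup>2"
        unfolding sum_product[symmetric] by (simp add: W_def inner_def power2_eq_square)
      finally show ?thesis .
    qed
    finally have "2 * W * inner u u \<le> (4 * W\<^sup>2 / m) * D" using u by (simp add: mult_ac)
    also have "\<dots> \<le> C * D"
      unfolding D_def using K_nonneg by (intro mult_right_mono C sum_nonneg) auto
    finally show ?thesis using C by (simp add: D field_simps)
  qed
  moreover have "0 \<le> 1 - W / C" "1 - W / C < 1" using C W by (auto simp: W_def field_simps)
  ultimately show ?thesis using that by blast
qed

text \<open>
  Writing \<open>P\<close> for \<open>avg\<close>, the operators \<open>c - P\<close> and \<open>1 + P\<close> commute and are positive
  semidefinite, hence so is their product \<open>AB\<close>: since \<open>A + B\<close> is the constant \<open>1 + c\<close>, we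
  have \<open>(1 + c) AB = ABA + BAB\<close>. Thus \<open>P\<^sup>2 \<le> c - (1 - c) P\<close>, and \<open>P \<le> P\<^sup>2\<close> gives the bound.
\<close>

lemma form_contract:
  assumes trickle: "\<And>u. form u u \<le> inner (avg u) (avg u)"
    and c: "0 \<le> c" "c < 1"
    and bound: "\<And>u. inner (\<lambda>_. 1) u = 0 \<Longrightarrow> form u u \<le> c * inner u u"
    and u: "inner (\<lambda>_. 1) u = 0"
  shows "form u u \<le> c / (2 - c) * inner u u"
proof -
  define v where "v = avg u"
  have v: "inner (\<lambda>_. 1) v = 0" using u by (simp add: v_def inner_one_avg)
  have uv: "inner u v = form u u" "form u v = inner v v"
    unfolding v_def inner_avg by (rule refl form_sym)+
  \<comment> \<open>The test vectors here and in the next estimate are \<open>Bu = u + Pu\<close>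
    and \<open>Au = c u - Pu\<close>; they give the nonnegativity of \<open>BAB\<close> and
    \<open>ABA\<close> respectively.\<close>
  have "form (\<lambda>p. 1 * u p + 1 * v p) (\<lambda>p. 1 * u p + 1 * v p)
      \<le> c * inner (\<lambda>p. 1 * u p + 1 * v p) (\<lambda>p. 1 * u p + 1 * v p)"
    using u v by (intro bound, subst inner_one_combine) simp
  moreover have "- inner (\<lambda>p. c * u p + (-1) * v p) (\<lambda>p. c * u p + (-1) * v p)
      \<le> form (\<lambda>p. c * u p + (-1) * v p) (\<lambda>p. c * u p + (-1) * v p)"
    by (rule form_ge)
  ultimately have "0 \<le> (1 + c) * (c * inner u u - (1 - c) * form u u - inner v v)"
    unfolding inner_combine form_combine uv by (simp add: algebra_simps power2_eq_square)
  then have "0 \<le> c * inner u u - (1 - c) * form u u - inner v v"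
    using c by (simp add: zero_le_mult_iff)
  then have "(2 - c) * form u u \<le> c * inner u u"
    using trickle[of u] by (simp add: v_def algebra_simps)
  then show ?thesis using c by (simp add: field_simps)
qed

text \<open>Every bound \<open>c\<close> reached by iterating \<open>form_contract\<close> stays at
  most \<open>a\<close>, so each round multiplies it by at most the fixed ratio
  \<open>q = 1 / (2 - a) < 1\<close>. The bounds therefore decay geometrically to 0.\<close>

lemma form_nonpos:
  assumes trickle: "\<And>u. form u u \<le> inner (avg u) (avg u)"
    and a: "0 \<le> a" "a < 1"
    and bound: "\<And>u. inner (\<lambda>_. 1) u = 0 \<Longrightarrow> form u u \<le> a * inner u u"
    and u: "inner (\<lambda>_. 1) u = 0"
  shows "form u u \<le> 0"
proof -
  define q where "q = 1 / (2 - a)"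
  have q: "0 \<le> q" "q < 1" using a by (auto simp: q_def)
  have iter: "form u u \<le> a * q ^ n * inner u u" if "inner (\<lambda>_. 1) u = 0" for n u
    using that
  proof (induction n arbitrary: u)
    case 0
    then show ?case using bound by simp
  next
    case (Suc n)
    define c where "c = a * q ^ n"
    have c: "0 \<le> c" "c \<le> a" using a q by (auto simp: c_def mult_left_le power_le_one)
    have "form u u \<le> c / (2 - c) * inner u u"
      using form_contract[OF trickle, of c] Suc c a by (simp add: c_def)
    also have "\<dots> \<le> c * q * inner u u"
      using c a unfolding q_def
      by (intro mult_right_mono inner_nonneg) (simp add: frac_le)
    finally show ?case by (simp add: c_def mult_ac)
  qed
  have "(\<lambda>n. a * q ^ n * inner u u) \<longlonglongrightarrow> a * 0 * inner u u"
    using q by (intro tendsto_intros LIMSEQ_power_zero) auto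
  then show ?thesis using iter[OF u] by (intro LIMSEQ_le_const) auto
qed

text \<open>Subtracting from \<open>u\<close> its mean \<open>c\<close> lowers
  \<open>form u u\<close> by exactly \<open>c\<^sup>2 * W\<close>, and what remains is nonpositive
  by \<open>form_nonpos\<close>. If the total weight is zero, the left side is zero.\<close>

lemma reverse_cauchy_schwarz:
  assumes trickle: "\<And>u. form u u \<le> inner (avg u) (avg u)"
    and conn: "\<And>p q. p \<in> V \<Longrightarrow> q \<in> V \<Longrightarrow> 0 < w p \<Longrightarrow> 0 < w q \<Longrightarrow>
      \<exists>r\<in>V. 0 < K p r \<and> 0 < K r q"
  shows "form u u * inner (\<lambda>_. 1) (\<lambda>_. 1) \<le> (inner (\<lambda>_. 1) u)\<^sup>2"
proof (cases "inner (\<lambda>_. 1) (\<lambda>_. 1) = 0")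
  case False
  define W where "W = inner (\<lambda>_. 1) (\<lambda>_. 1)"
  define c where "c = inner (\<lambda>_. 1) u / W"
  have W: "0 < W" using False inner_nonneg[of "\<lambda>_. 1"] by (simp add: W_def)
  obtain a where a: "0 \<le> a" "a < 1" "\<And>u. inner (\<lambda>_. 1) u = 0 \<Longrightarrow> form u u \<le> a * inner u u"
    by (rule spectral_gap[OF conn W[unfolded W_def]]) (use that in auto)
  have cW: "c * W = inner (\<lambda>_. 1) u" using W by (simp add: c_def)
  have "inner (\<lambda>_. 1) (\<lambda>p. 1 * u p + (- c) * 1) = 0"
    unfolding inner_one_combine using cW by (simp add: W_def)
  then have "form (\<lambda>p. 1 * u p + (- c) * 1) (\<lambda>p. 1 * u p + (- c) * 1) \<le> 0"
    by (intro form_nonpos[OF trickle a])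
  then have "form u u - 2 * c * (c * W) + c\<^sup>2 * W \<le> 0"
    unfolding form_combine form_sym[of u "\<lambda>_. 1"] form_one cW by (simp add: W_def)
  then have "form u u \<le> c\<^sup>2 * W" by (simp add: power2_eq_square algebra_simps)
  then have "form u u * W \<le> c\<^sup>2 * W * W" using W by (intro mult_right_mono) auto
  also have "\<dots> = (inner (\<lambda>_. 1) u)\<^sup>2" by (simp flip: cW add: power2_eq_square)
  finally show ?thesis by (simp add: W_def)
qed simp

end

section \<open>Complete multipartite forms\<close>

lemma sum_squares_le_square_sum:
  fixes t :: "'c \<Rightarrow> real"
  assumes "finite C" "\<And>c. c \<in> C \<Longrightarrow> 0 \<le> t c"
  shows "(\<Sum>c\<in>C. (t c)\<^sup>2) \<le> (\<Sum>c\<in>C. t c)\<^sup>2"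
  unfolding power2_eq_square sum_distrib_right
  using assms by (intro sum_mono mult_left_mono member_le_sum) auto

text \<open>In the notation of the proof, right side minus left side equals
  \<open>Z - (a * b - c\<^sup>2)\<close>, where \<open>Z\<close> is the squared norm of the vector
  \<open>x N - t X\<close>. Replacing \<open>x\<close> by this vector multiplies the Gram
  determinant \<open>a * b - c\<^sup>2\<close> by \<open>N\<^sup>2\<close>, so that determinant is
  at most \<open>b * Z / N\<^sup>2\<close>; nonnegativity of \<open>t\<close> gives
  \<open>b \<le> N\<^sup>2\<close>.\<close>

lemma elementary_symmetric_reverse_cauchy_schwarz:
  fixes x t :: "'c \<Rightarrow> real"
  assumes C: "finite C" and t: "\<And>c. c \<in> C \<Longrightarrow> 0 \<le> t c"
  shows "((\<Sum>c\<in>C. x c)\<^sup>2 - (\<Sum>c\<in>C. (x c)\<^sup>2)) * ((\<Sum>c\<in>C. t c)\<^sup>2 - (\<Sum>c\<in>C. (t c)\<^sup>2))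
    \<le> ((\<Sum>c\<in>C. x c) * (\<Sum>c\<in>C. t c) - (\<Sum>c\<in>C. x c * t c))\<^sup>2"
proof (cases "(\<Sum>c\<in>C. t c) = 0")
  case True
  then have "\<forall>c\<in>C. t c = 0" using t C by (simp add: sum_nonneg_eq_0_iff)
  then show ?thesis by simp
next
  case False
  define X N a b c where "X = (\<Sum>c\<in>C. x c)" and "N = (\<Sum>c\<in>C. t c)"
    and "a = (\<Sum>c\<in>C. (x c)\<^sup>2)" and "b = (\<Sum>c\<in>C. (t c)\<^sup>2)" and "c = (\<Sum>c\<in>C. x c * t c)"
  define Z where "Z = (\<Sum>c\<in>C. (x c * N - t c * X)\<^sup>2)"
  have Z: "Z = N\<^sup>2 * a - 2 * N * X * c + X\<^sup>2 * b"
    unfolding Z_def a_def b_def c_def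
    by (simp add: sum_distrib_left flip: sum.distrib sum_subtractf)
       (simp add: algebra_simps power2_eq_square)
  have "N\<^sup>2 * (a * b - c\<^sup>2) = b * Z - (N * c - X * b)\<^sup>2"
    unfolding Z by (simp add: algebra_simps power2_eq_square)
  also have "\<dots> \<le> b * Z" by simp
  also have "\<dots> \<le> N\<^sup>2 * Z"
    unfolding b_def N_def Z_def using sum_squares_le_square_sum[OF C t]
    by (intro mult_right_mono sum_nonneg) auto
  finally have "a * b - c\<^sup>2 \<le> Z" using False by (simp add: N_def)
  then have "(X\<^sup>2 - a) * (N\<^sup>2 - b) \<le> (X * N - c)\<^sup>2"
    unfolding Z by (simp add: algebra_simps power2_eq_square)
  then show ?thesis by (simp add: X_def N_def a_def b_def c_def)
qed

text \<open>All pairs minus the pairs with equal labels, grouped by label, so that only the class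
  sums of \<open>x\<close> and \<open>y\<close> remain.\<close>

lemma sum_different_labels:
  fixes x y :: "'a \<Rightarrow> real" and h :: "'a \<Rightarrow> 'c"
  assumes A: "finite A"
  shows "(\<Sum>p\<in>A. \<Sum>q\<in>A. if h p = h q then 0 else x p * y q)
    = (\<Sum>c\<in>h ` A. \<Sum>p | p \<in> A \<and> h p = c. x p) * (\<Sum>c\<in>h ` A. \<Sum>p | p \<in> A \<and> h p = c. y p)
      - (\<Sum>c\<in>h ` A. (\<Sum>p | p \<in> A \<and> h p = c. x p) * (\<Sum>p | p \<in> A \<and> h p = c. y p))"
proof -
  have "(\<Sum>p\<in>A. \<Sum>q\<in>A. if h p = h q then 0 else x p * y q)
      = (\<Sum>p\<in>A. \<Sum>q\<in>A. x p * y q) - (\<Sum>p\<in>A. \<Sum>q\<in>A. if h q = h p then x p * y q else 0)"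
    unfolding sum_subtractf[symmetric] by (intro sum.cong) auto
  also have "(\<Sum>p\<in>A. \<Sum>q\<in>A. x p * y q) = (\<Sum>p\<in>A. x p) * (\<Sum>q\<in>A. y q)"
    by (simp add: sum_product)
  also have "(\<Sum>p\<in>A. \<Sum>q\<in>A. if h q = h p then x p * y q else 0)
      = (\<Sum>p\<in>A. x p * (\<Sum>q | q \<in> A \<and> h q = h p. y q))"
    using A by (simp add: sum.inter_filter[symmetric] sum_distrib_left)
  also have "\<dots> = (\<Sum>c\<in>h ` A. \<Sum>p | p \<in> A \<and> h p = c. x p * (\<Sum>q | q \<in> A \<and> h q = h p. y q))"
    using A by (rule sum.image_gen)
  also have "\<dots> = (\<Sum>c\<in>h ` A. (\<Sum>p | p \<in> A \<and> h p = c. x p) * (\<Sum>q | q \<in> A \<and> h q = c. y q))"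
    unfolding sum_distrib_right by (intro sum.cong) auto
  finally show ?thesis
    using sum.image_gen[OF A, of x h] sum.image_gen[OF A, of y h] by simp
qed

text \<open>The previous inequality applied to the class sums of \<open>t * u\<close> and of
  \<open>t\<close>. Only the latter need be nonnegative, so \<open>u\<close> may have any
  signs.\<close>

lemma different_labels_reverse_cauchy_schwarz:
  fixes u t :: "'a \<Rightarrow> real" and h :: "'a \<Rightarrow> 'c"
  assumes A: "finite A" and t: "\<And>p. p \<in> A \<Longrightarrow> 0 \<le> t p"
  defines "Q \<equiv> \<lambda>p q. if h p = h q then 0 else t p * t q"
  shows "(\<Sum>p\<in>A. \<Sum>q\<in>A. Q p q * u p * u q) * (\<Sum>p\<in>A. \<Sum>q\<in>A. Q p q)
    \<le> (\<Sum>p\<in>A. \<Sum>q\<in>A. Q p q * u p)\<^sup>2"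
proof -
  have eqs: "(\<Sum>p\<in>A. \<Sum>q\<in>A. Q p q * u p * u q)
      = (\<Sum>p\<in>A. \<Sum>q\<in>A. if h p = h q then 0 else (t p * u p) * (t q * u q))"
    "(\<Sum>p\<in>A. \<Sum>q\<in>A. Q p q * u p) = (\<Sum>p\<in>A. \<Sum>q\<in>A. if h p = h q then 0 else (t p * u p) * t q)"
    by (auto simp: Q_def intro!: sum.cong)
  show ?thesis
    unfolding eqs unfolding Q_def sum_different_labels[OF A]
    using elementary_symmetric_reverse_cauchy_schwarz[OF finite_imageI[OF A], of h
        "\<lambda>c. \<Sum>p | p \<in> A \<and> h p = c. t p" "\<lambda>c. \<Sum>p | p \<in> A \<and> h p = c. t p * u p"] t
    unfolding power2_eq_square by (blast intro: sum_nonneg)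
qed

section \<open>The kernel of a rank three matroid\<close>

locale weighted_rank_three_matroid =
  fixes E :: "'a set" and \<M> :: "'a set set" and y :: "'a \<Rightarrow> real"
  assumes matroid: "matroid E \<M>"
    and rank: "matroid_rank \<M> = 3"
    and y_pos: "\<And>e. e \<in> E \<Longrightarrow> 0 < y e"
begin

section \<open>Basis exchange and connectivity in rank three\<close>

lemma finite_E: "finite E"
  using matroid by (simp add: matroid_def)

lemma finite_bases: "finite \<M>"
  using matroid finite_subset[of \<M> "Pow E"] by (auto simp: matroid_def)

lemma basis_subset: "B \<in> \<M> \<Longrightarrow> B \<subseteq> E"
  using matroid_basis[OF matroid] by simp

lemma card_basis: "B \<in> \<M> \<Longrightarrow> card B = 3"
  using card_basis_eq_rank[OF matroid] rank by simp

lemma basis_distinct: "{p, q, r} \<in> \<M> \<Longrightarrow> p \<noteq> q \<and> p \<noteq> r \<and> q \<noteq> r"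
  using card_basis[of "{p, q, r}"] by (auto simp: card_insert_if split: if_splits)

lemma basis_cases:
  assumes "B \<in> \<M>"
  obtains p q r where "B = {p, q, r}" "p \<noteq> q" "p \<noteq> r" "q \<noteq> r"
  using card_basis[OF assms] by (auto simp: card_3_iff)

text \<open>In the contraction by \<open>r\<close>, which has rank two, \<open>z\<close> witnesses
  that \<open>s\<close> is not a loop, and a nonloop cannot be parallel to both elements of the
  basis \<open>p\<close>, \<open>q\<close>.\<close>

lemma link_exchange:
  assumes s: "{r, s, z} \<in> \<M>" and pq: "{r, p, q} \<in> \<M>"
  shows "{r, p, s} \<in> \<M> \<or> {r, q, s} \<in> \<M>"
proof (cases "z \<in> {p, q}")
  case True
  then show ?thesis using s by (auto simp: insert_commute)
next
  case False
  then have "z \<in> {r, s, z} - {r, p, q}" using basis_distinct[OF s] by auto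
  then obtain b where b: "b \<in> {r, p, q} - {r, s, z}" "insert b ({r, s, z} - {z}) \<in> \<M>"
    by (rule matroid_exchange[OF matroid s pq])
  moreover have "insert b ({r, s, z} - {z}) = {r, b, s}" using basis_distinct[OF s] by auto
  ultimately show ?thesis by auto
qed

text \<open>Exchanging \<open>c\<close> against the other basis brings \<open>p\<close>,
  \<open>a\<close> or \<open>b\<close> into a basis with \<open>q\<close>. In the last two cases
  that element is the neighbour sought. If it is \<open>p\<close>, then \<open>link_exchange\<close>
  in the contraction by \<open>p\<close> puts \<open>q\<close> into a basis with \<open>a\<close> or
  \<open>b\<close>.\<close>

lemma common_neighbour:
  assumes "{p, a, b} \<in> \<M>" "{q, c, d} \<in> \<M>"
  shows "\<exists>r s t. {p, r, s} \<in> \<M> \<and> {r, q, t} \<in> \<M>"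
proof -
  have *: "{p, b, a} \<in> \<M>" using assms by (simp add: insert_commute)
  have abq: ?thesis if "{q, e, x} \<in> \<M>" "e \<in> {a, b}" for e x
  proof -
    have "{e, q, x} \<in> \<M>" using that by (simp add: insert_commute)
    then show ?thesis using that(2) assms(1) * by blast
  qed
  have pq: ?thesis if pd: "{q, p, d} \<in> \<M>" for d
  proof -
    have "{p, q, d} \<in> \<M>" using pd by (simp add: insert_commute)
    then have "{p, a, q} \<in> \<M> \<or> {p, b, q} \<in> \<M>" by (rule link_exchange[OF _ assms(1)])
    then have "{q, a, p} \<in> \<M> \<or> {q, b, p} \<in> \<M>" by (simp add: insert_commute)
    then show ?thesis using abq by blast
  qed
  show ?thesis
  proof (cases "c \<in> {p, a, b}")
    case True
    then show ?thesis using abq pq assms(2) by blast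
  next
    case False
    then have "c \<in> {q, c, d} - {p, a, b}" by simp
    then obtain e where e: "e \<in> {p, a, b} - {q, c, d}" "insert e ({q, c, d} - {c}) \<in> \<M>"
      by (rule matroid_exchange[OF matroid assms(2,1)])
    moreover have "insert e ({q, c, d} - {c}) = {q, e, d}" using basis_distinct[OF assms(2)] by auto
    ultimately show ?thesis using abq pq by auto
  qed
qed

section \<open>The weighted kernel and its links\<close>

definition T :: "'a \<Rightarrow> 'a \<Rightarrow> 'a \<Rightarrow> real" where
  "T p q r = (if {p, q, r} \<in> \<M> then y p * y q * y r else 0)"

text \<open>This is the Hessian of the basis generating polynomial at \<open>y\<close>, with row
  \<open>p\<close> and column \<open>q\<close> scaled by \<open>y p\<close> and \<open>y q\<close>.
  The diagonal is zero because bases have three distinct elements.\<close>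

definition K :: "'a \<Rightarrow> 'a \<Rightarrow> real" where
  "K p q = (\<Sum>r\<in>E. T p q r)"

lemma T_nonneg: "0 \<le> T p q r"
  using basis_subset[of "{p, q, r}"] y_pos by (simp add: T_def less_imp_le)

lemma T_rotate: "T p q r = T r p q"
  by (simp add: T_def insert_commute mult_ac)

sublocale nonneg_kernel E K
proof
  show "K p q = K q p" for p q
    unfolding K_def T_def by (intro sum.cong) (auto simp: insert_commute mult_ac)
qed (auto simp: finite_E K_def intro: sum_nonneg T_nonneg)

lemma K_pos:
  assumes "{p, q, r} \<in> \<M>"
  shows "0 < K p q"
proof -
  have "0 < T p q r" using assms basis_subset[OF assms] y_pos by (simp add: T_def)
  also have "\<dots> \<le> K p q"
    unfolding K_def using finite_E T_nonneg basis_subset[OF assms] by (intro member_le_sum) auto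
  finally show ?thesis .
qed

lemma w_pos_basis:
  assumes "0 < w p"
  obtains q r where "{p, q, r} \<in> \<M>"
proof -
  have "\<exists>q\<in>E. \<exists>r\<in>E. T p q r \<noteq> 0"
  proof (rule ccontr)
    assume "\<not> ?thesis"
    then have "w p = 0" by (simp add: w_def K_def)
    with assms show False by simp
  qed
  then show ?thesis using that by (auto simp: T_def split: if_splits)
qed

lemma kernel_connected:
  assumes "0 < w p" "0 < w q"
  shows "\<exists>r\<in>E. 0 < K p r \<and> 0 < K r q"
proof -
  obtain a b c d where "{p, a, b} \<in> \<M>" "{q, c, d} \<in> \<M>"
    using w_pos_basis assms by metis
  then obtain r s t where "{p, r, s} \<in> \<M>" "{r, q, t} \<in> \<M>"
    using common_neighbour by blast
  then show ?thesis using K_pos basis_subset by blast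
qed

text \<open>Two nonloops of the contraction by \<open>r\<close> form a basis there unless they are
  parallel, and parallelism is an equivalence relation. Hence the link is a complete multipartite
  form whose parts are the parallel classes.\<close>

lemma link_reverse_cauchy_schwarz:
  "(\<Sum>p\<in>E. \<Sum>q\<in>E. T r p q * u p * u q) * (\<Sum>p\<in>E. \<Sum>q\<in>E. T r p q)
    \<le> (\<Sum>p\<in>E. \<Sum>q\<in>E. T r p q * u p)\<^sup>2"
proof (cases "r \<in> E")
  case False
  then have "T r p q = 0" for p q using basis_subset by (auto simp: T_def)
  then show ?thesis by simp
next
  case True
  define N where "N = {p. \<exists>q. {r, p, q} \<in> \<M>}"
  \<comment> \<open>The label of a nonloop is its own parallel class. Loops also receive labels, but
    the zero weight \<open>t\<close> removes them from every sum.\<close>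
  define h where "h p = {q \<in> N. {r, p, q} \<notin> \<M>}" for p
  define t where "t p = (if p \<in> N then y p else 0)" for p
  have comm: "{r, q, p} \<in> \<M> \<longleftrightarrow> {r, p, q} \<in> \<M>" for p q
    by (simp add: insert_commute)
  have step: "{r, p, s} \<in> \<M> \<or> {r, q, s} \<in> \<M>" if "s \<in> N" "{r, p, q} \<in> \<M>" for p q s
    using that link_exchange[of r s _ p q] unfolding N_def by blast
  have h: "h p = h q \<longleftrightarrow> {r, p, q} \<notin> \<M>" if "p \<in> N" "q \<in> N" for p q
  proof
    assume hpq: "h p = h q"
    have "q \<in> h q" using that basis_distinct[of r q q] by (auto simp: h_def)
    then have "q \<in> h p" unfolding hpq .
    then show "{r, p, q} \<notin> \<M>" by (simp add: h_def)
  next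
    assume "{r, p, q} \<notin> \<M>"
    then show "h p = h q"
      unfolding h_def using step[OF that(1)] step[OF that(2)] comm by blast
  qed
  have T: "T r p q = y r * (if h p = h q then 0 else t p * t q)" for p q
  proof (cases "p \<in> N \<and> q \<in> N")
    case True
    then show ?thesis using h by (simp add: T_def t_def)
  next
    case False
    then have "{r, p, q} \<notin> \<M>" using comm by (auto simp: N_def)
    then show ?thesis using False by (auto simp: T_def t_def)
  qed
  define Q where "Q p q = (if h p = h q then 0 else t p * t q)" for p q
  have "(\<Sum>p\<in>E. \<Sum>q\<in>E. Q p q * u p * u q) * (\<Sum>p\<in>E. \<Sum>q\<in>E. Q p q)
    \<le> (\<Sum>p\<in>E. \<Sum>q\<in>E. Q p q * u p)\<^sup>2"
    unfolding Q_def using finite_E y_pos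
    by (intro different_labels_reverse_cauchy_schwarz) (auto simp: t_def less_imp_le)
  then have "(y r)\<^sup>2 * ((\<Sum>p\<in>E. \<Sum>q\<in>E. Q p q * u p * u q) * (\<Sum>p\<in>E. \<Sum>q\<in>E. Q p q))
    \<le> (y r)\<^sup>2 * (\<Sum>p\<in>E. \<Sum>q\<in>E. Q p q * u p)\<^sup>2"
    by (intro mult_left_mono) auto
  then show ?thesis
    unfolding T Q_def[symmetric] mult.assoc sum_distrib_left[symmetric]
    by (simp add: power2_eq_square mult_ac)
qed

text \<open>The form splits into the link forms \<open>F r\<close>. The link at \<open>r\<close> has
  total mass \<open>w r\<close>, and the mean of \<open>u\<close> over it is \<open>avg u r\<close>;
  the link inequality divided by \<open>w r\<close> bounds \<open>F r\<close> by the term of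
  \<open>r\<close> in the inner product.\<close>

lemma trickle: "form u u \<le> inner (avg u) (avg u)"
proof -
  define F where "F r = (\<Sum>p\<in>E. \<Sum>q\<in>E. T r p q * u p * u q)" for r
  have w: "w r = (\<Sum>p\<in>E. \<Sum>q\<in>E. T r p q)" for r
    by (simp add: w_def K_def)
  have "form u u = (\<Sum>p\<in>E. \<Sum>q\<in>E. \<Sum>r\<in>E. T r p q * u p * u q)"
    by (simp add: form_def K_def sum_distrib_right T_rotate)
  also have "\<dots> = (\<Sum>p\<in>E. \<Sum>r\<in>E. \<Sum>q\<in>E. T r p q * u p * u q)"
    by (intro sum.cong sum.swap) auto
  also have "\<dots> = (\<Sum>r\<in>E. F r)"
    unfolding F_def by (rule sum.swap)
  also have "\<dots> \<le> (\<Sum>r\<in>E. w r * avg u r * avg u r)"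
  proof (rule sum_mono)
    fix r assume r: "r \<in> E"
    have "(\<Sum>p\<in>E. \<Sum>q\<in>E. T r p q * u p) = w r * avg u r"
      by (simp add: w_avg[OF r] K_def sum_distrib_right)
    then have le: "F r * w r \<le> (w r * avg u r)\<^sup>2"
      using link_reverse_cauchy_schwarz[of r u] by (simp add: F_def w)
    show "F r \<le> w r * avg u r * avg u r"
    proof (cases "w r = 0")
      case True
      have "T r p q = 0" if "p \<in> E" "q \<in> E" for p q
        using K_eq_0[OF True r that(1)] sum_nonneg_eq_0_iff[OF finite_E, of "T r p"] T_nonneg that
        by (auto simp: K_def)
      then show ?thesis by (simp add: F_def True)
    next
      case False
      then have "0 < w r" using w_nonneg[OF r] by simp
      with le show ?thesis by (simp add: power2_eq_square mult_ac)
    qed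
  qed
  finally show ?thesis by (simp add: inner_def)
qed

section \<open>From quadratic forms to basis sums\<close>

lemma form_eq_sum_bases:
  "form u v = (\<Sum>B\<in>\<M>. (\<Prod>e\<in>B. y e) * ((\<Sum>e\<in>B. u e) * (\<Sum>e\<in>B. v e) - (\<Sum>e\<in>B. u e * v e)))"
proof -
  \<comment> \<open>\<open>g B\<close> picks out the ordered triples that enumerate
    \<open>B\<close>, so that the sum over bases can be moved outside. Six triples per basis
    survive, one for each ordered pair of distinct elements.\<close>
  define g where "g B p q r = (if {p, q, r} = B then (\<Prod>e\<in>B. y e) * u p * v q else 0)" for B p q r
  have "T p q r * u p * v q = (\<Sum>B\<in>\<M>. g B p q r)" for p q r
  proof -
    have "(\<Sum>B\<in>\<M>. g B p q r) = (if {p, q, r} \<in> \<M> then (\<Prod>e\<in>{p, q, r}. y e) * u p * v q else 0)"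
      unfolding g_def using finite_bases by simp
    then show ?thesis using basis_distinct[of p q r] by (auto simp: T_def mult_ac)
  qed
  then have "form u v = (\<Sum>p\<in>E. \<Sum>q\<in>E. \<Sum>r\<in>E. \<Sum>B\<in>\<M>. g B p q r)"
    by (simp add: form_def K_def sum_distrib_right)
  also have "\<dots> = (\<Sum>B\<in>\<M>. \<Sum>p\<in>E. \<Sum>q\<in>E. \<Sum>r\<in>E. g B p q r)"
    unfolding sum.swap[of _ \<M>] ..
  also have "\<dots> = (\<Sum>B\<in>\<M>. (\<Prod>e\<in>B. y e) *
      ((\<Sum>e\<in>B. u e) * (\<Sum>e\<in>B. v e) - (\<Sum>e\<in>B. u e * v e)))"
  proof (rule sum.cong[OF refl])
    fix B assume B: "B \<in> \<M>"
    have g0: "g B p q r = 0" if "p \<notin> B \<or> q \<notin> B \<or> r \<notin> B" for p q r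
      using that by (auto simp: g_def)
    have "(\<Sum>p\<in>E. \<Sum>q\<in>E. \<Sum>r\<in>E. g B p q r) = (\<Sum>p\<in>B. \<Sum>q\<in>B. \<Sum>r\<in>B. g B p q r)"
      using basis_subset[OF B] finite_E g0
      by (intro sum.mono_neutral_cong_right sum.neutral ballI) auto
    also obtain a b c where abc: "B = {a, b, c}" "a \<noteq> b" "a \<noteq> c" "b \<noteq> c"
      using B by (rule basis_cases)
    have "(\<Sum>p\<in>B. \<Sum>q\<in>B. \<Sum>r\<in>B. g B p q r)
        = (\<Prod>e\<in>B. y e) * (u a * v b + u a * v c + u b * v a + u b * v c + u c * v a + u c * v b)"
      using abc(2-4) unfolding g_def abc(1)
      by (simp add: insert_eq_iff insert_commute doubleton_eq_iff algebra_simps)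
    also have "\<dots> = (\<Prod>e\<in>B. y e) * ((\<Sum>e\<in>B. u e) * (\<Sum>e\<in>B. v e) - (\<Sum>e\<in>B. u e * v e))"
      using abc by (simp add: algebra_simps)
    finally show "(\<Sum>p\<in>E. \<Sum>q\<in>E. \<Sum>r\<in>E. g B p q r)
      = (\<Prod>e\<in>B. y e) * ((\<Sum>e\<in>B. u e) * (\<Sum>e\<in>B. v e) - (\<Sum>e\<in>B. u e * v e))" .
  qed
  finally show ?thesis .
qed

lemma sum_bases_by_card:
  fixes f :: "nat \<Rightarrow> real"
  shows "(\<Sum>B\<in>\<M>. (\<Prod>e\<in>B. y e) * f (card (B \<inter> S))) = (\<Sum>j\<le>3. f j * basis_sum \<M> j S y)"
proof -
  have "card (B \<inter> S) \<le> 3" if "B \<in> \<M>" for B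
    using card_mono[of B "B \<inter> S"] matroid_basis(2)[OF matroid that] card_basis[OF that] by simp
  then have "(\<lambda>B. card (B \<inter> S)) ` \<M> \<subseteq> {..3}" by auto
  then have "(\<Sum>B\<in>\<M>. (\<Prod>e\<in>B. y e) * f (card (B \<inter> S)))
      = (\<Sum>j\<le>3. \<Sum>B | B \<in> \<M> \<and> card (B \<inter> S) = j. (\<Prod>e\<in>B. y e) * f (card (B \<inter> S)))"
    using finite_bases by (subst sum.group) auto
  also have "\<dots> = (\<Sum>j\<le>3. f j * basis_sum \<M> j S y)"
    unfolding basis_sum_def sum_distrib_left by (intro sum.cong) auto
  finally show ?thesis .
qed

text \<open>Reverse Cauchy-Schwarz for the indicator \<open>u\<close> of \<open>S\<close>. A basis
  meeting \<open>S\<close> in \<open>k\<close> elements contributes its weight times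
  \<open>k * (k - 1)\<close> to \<open>form u u\<close>, times \<open>2 * k\<close> to the mixed
  term and times 6 to the total; a common factor 4 cancels.\<close>

lemma basis_sum_inequality:
  fixes S :: "'a set"
  defines "m \<equiv> \<lambda>j. basis_sum \<M> j S y"
  shows "3 * (m 2 + 3 * m 3) * (m 0 + m 1 + m 2 + m 3) \<le> (m 1 + 2 * m 2 + 3 * m 3)\<^sup>2"
proof -
  define u :: "'a \<Rightarrow> real" where "u e = (if e \<in> S then 1 else 0)" for e
  have u: "(\<Sum>e\<in>B. u e) = real (card (B \<inter> S))" "(\<Sum>e\<in>B. u e * u e) = real (card (B \<inter> S))"
    if "B \<in> \<M>" for B
    using matroid_basis(2)[OF matroid that] by (auto simp: u_def sum.If_cases Int_def if_distrib[of "\<lambda>x. x * _"] cong: if_cong)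
  have range: "{..3} = {0, 1, 2, 3 :: nat}" by auto
  have "form u u = (\<Sum>B\<in>\<M>. (\<Prod>e\<in>B. y e) * (real (card (B \<inter> S)) * real (card (B \<inter> S)) - real (card (B \<inter> S))))"
    unfolding form_eq_sum_bases by (intro sum.cong) (simp_all add: u)
  then have uu: "form u u = 2 * m 2 + 6 * m 3"
    by (simp add: sum_bases_by_card[of "\<lambda>j. real j * real j - real j"] range m_def)
  have "form (\<lambda>_. 1) u = (\<Sum>B\<in>\<M>. (\<Prod>e\<in>B. y e) * (2 * real (card (B \<inter> S))))"
    unfolding form_eq_sum_bases by (intro sum.cong) (simp_all add: u card_basis)
  then have one_u: "inner (\<lambda>_. 1) u = 2 * m 1 + 4 * m 2 + 6 * m 3"
    by (simp add: sum_bases_by_card[of "\<lambda>j. 2 * real j"] range m_def form_one)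
  have "form (\<lambda>_. 1) (\<lambda>_. 1) = (\<Sum>B\<in>\<M>. (\<Prod>e\<in>B. y e) * 6)"
    unfolding form_eq_sum_bases by (intro sum.cong) (simp_all add: card_basis)
  then have one_one: "inner (\<lambda>_. 1) (\<lambda>_. 1) = 6 * (m 0 + m 1 + m 2 + m 3)"
    using sum_bases_by_card[of "\<lambda>_. 6" S] by (simp add: range m_def form_one)
  have "form u u * inner (\<lambda>_. 1) (\<lambda>_. 1) \<le> (inner (\<lambda>_. 1) u)\<^sup>2"
    using kernel_connected by (intro reverse_cauchy_schwarz trickle)
  then show ?thesis
    unfolding uu one_u one_one by (simp add: algebra_simps power2_eq_square)
qed

end

section \<open>Newton inequalities and duality\<close>

lemma basis_sum_scale:
  assumes "matroid E \<M>"
  shows "basis_sum \<M> j S (\<lambda>e. if e \<in> S then x * y e else y e) = x ^ j * basis_sum \<M> j S y"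
proof -
  have "(\<Prod>e\<in>B. if e \<in> S then x * y e else y e) = x ^ card (B \<inter> S) * (\<Prod>e\<in>B. y e)" if "B \<in> \<M>" for B
  proof -
    have fin: "finite B" using matroid_basis[OF assms that] by simp
    have "(\<Prod>e\<in>B. if e \<in> S then x * y e else y e) = (\<Prod>e\<in>B. (if e \<in> S then x else 1) * y e)"
      by (intro prod.cong) auto
    then show ?thesis using fin by (simp add: prod.distrib prod.If_cases Int_def)
  qed
  then show ?thesis
    unfolding basis_sum_def sum_distrib_left by (intro sum.cong) auto
qed

text \<open>Letting \<open>x\<close> tend to 0 from the right isolates \<open>a\<close>; replacing
  \<open>x\<close> by \<open>1 / x\<close> reverses the polynomial and so isolates
  \<open>c\<close>.\<close>

lemma quadratic_nonneg_imp_coeffs_nonneg: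
  fixes a b c :: real
  assumes "\<And>x. 0 < x \<Longrightarrow> 0 \<le> a + b * x + c * x\<^sup>2"
  shows "0 \<le> a" "0 \<le> c"
proof -
  have const_coeff: "0 \<le> a" if q: "\<And>x. 0 < x \<Longrightarrow> 0 \<le> a + b * x + c * x\<^sup>2" for a b c :: real
  proof -
    have "((\<lambda>x. a + b * x + c * x\<^sup>2) \<longlongrightarrow> a + b * 0 + c * 0\<^sup>2) (at_right 0)"
      by (intro tendsto_intros)
    moreover have "eventually (\<lambda>x. 0 \<le> a + b * x + c * x\<^sup>2) (at_right 0)"
      using eventually_at_right_less[of "0::real"] by eventually_elim (rule q)
    ultimately have "0 \<le> a + b * 0 + c * 0\<^sup>2"
      by (intro tendsto_lowerbound[OF _ _ trivial_limit_at_right_real])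
    then show ?thesis by simp
  qed
  show "0 \<le> a" using assms by (rule const_coeff)
  have "0 \<le> c + b * x + a * x\<^sup>2" if "0 < x" for x
  proof -
    have "0 \<le> (a + b * (1 / x) + c * (1 / x)\<^sup>2) * x\<^sup>2" using assms[of "1 / x"] that by simp
    also have "\<dots> = c + b * x + a * x\<^sup>2" using that by (simp add: field_simps power2_eq_square)
    finally show ?thesis .
  qed
  then show "0 \<le> c" by (rule const_coeff)
qed

lemma (in weighted_rank_three_matroid) basis_sum_newton:
  fixes S :: "'a set"
  defines "m \<equiv> \<lambda>j. basis_sum \<M> j S y"
  shows "3 * m 0 * m 2 \<le> (m 1)\<^sup>2" "3 * m 1 * m 3 \<le> (m 2)\<^sup>2"
proof -
  have "0 \<le> ((m 1)\<^sup>2 - 3 * m 0 * m 2) + (m 1 * m 2 - 9 * m 0 * m 3) * x + ((m 2)\<^sup>2 - 3 * m 1 * m 3) * x\<^sup>2"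
    if x: "0 < x" for x
  proof -
    interpret scaled: weighted_rank_three_matroid E \<M> "\<lambda>e. if e \<in> S then x * y e else y e"
      by unfold_locales (use matroid rank y_pos x in auto)
    have "3 * (x\<^sup>2 * m 2 + 3 * (x ^ 3 * m 3)) * (m 0 + x * m 1 + x\<^sup>2 * m 2 + x ^ 3 * m 3)
        \<le> (x * m 1 + 2 * (x\<^sup>2 * m 2) + 3 * (x ^ 3 * m 3))\<^sup>2"
      using scaled.basis_sum_inequality[of S] by (simp add: basis_sum_scale[OF matroid] m_def)
    \<comment> \<open>On expansion the terms of degree five and six cancel, which leaves
      \<open>x\<^sup>2\<close> times a quadratic.\<close>
    then have "0 \<le> x\<^sup>2 * (((m 1)\<^sup>2 - 3 * m 0 * m 2) + (m 1 * m 2 - 9 * m 0 * m 3) * x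
        + ((m 2)\<^sup>2 - 3 * m 1 * m 3) * x\<^sup>2)"
      by (simp add: algebra_simps power2_eq_square power3_eq_cube)
    then show ?thesis using x by (simp add: zero_le_mult_iff)
  qed
  from quadratic_nonneg_imp_coeffs_nonneg[OF this]
  show "3 * m 0 * m 2 \<le> (m 1)\<^sup>2" "3 * m 1 * m 3 \<le> (m 2)\<^sup>2" by simp_all
qed

text \<open>The factor is Newton's \<open>(1 + 1 / j) * (1 + 1 / (3 - j))\<close>, equal to 3 for
  both \<open>j = 1\<close> and \<open>j = 2\<close>. For larger \<open>j\<close> no basis has
  \<open>j + 1\<close> elements in \<open>S\<close>.\<close>

lemma (in weighted_rank_three_matroid) basis_sum_ultra_log_concave:
  assumes "1 \<le> j"
  shows "3 * (basis_sum \<M> (j - 1) S y * basis_sum \<M> (j + 1) S y) \<le> (basis_sum \<M> j S y)\<^sup>2"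
proof (cases "j \<le> 2")
  case True
  then consider "j = 1" | "j = 2" using assms by linarith
  then show ?thesis using basis_sum_newton[of S] by cases (simp_all add: numeral_2_eq_2 numeral_3_eq_3 mult.assoc)
next
  case False
  have "card (B \<inter> S) \<noteq> j + 1" if "B \<in> \<M>" for B
    using card_mono[of B "B \<inter> S"] matroid_basis(2)[OF matroid that] card_basis[OF that] False by simp
  then have "{B \<in> \<M>. card (B \<inter> S) = j + 1} = {}" by blast
  then have "basis_sum \<M> (j + 1) S y = 0" unfolding basis_sum_def by (simp only: sum.empty)
  then show ?thesis by simp
qed

lemma basis_sum_nonneg:
  assumes "matroid E \<M>" "\<forall>e\<in>E. 0 < y e"
  shows "0 \<le> basis_sum \<M> j S y"
  unfolding basis_sum_def using assms matroid_basis(1)[OF assms(1)]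
  by (intro sum_nonneg prod_nonneg) (auto simp: less_imp_le subset_iff)

text \<open>The required factor is at most 2, because the minimum is at least 1. Strictness comes
  from the gap between 2 and the available factor 3, together with
  \<open>basis_sum \<M> j S y \<noteq> 0\<close>.\<close>

lemma rank_three_sqrt_BLC:
  assumes "matroid E \<M>" "matroid_rank \<M> = 3"
  shows "sqrt_BLC E \<M>"
  unfolding sqrt_BLC_def
proof (intro allI impI)
  fix y :: "'a \<Rightarrow> real" and S j
  assume y: "\<forall>e\<in>E. 0 < y e" and j: "1 \<le> j" "j \<le> card S - 1"
    and nonzero: "basis_sum \<M> j S y \<noteq> 0"
  interpret weighted_rank_three_matroid E \<M> y
    by unfold_locales (use assms y in auto)
  define P where "P = basis_sum \<M> (j - 1) S y * basis_sum \<M> (j + 1) S y"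
  have "0 \<le> P" unfolding P_def by (intro mult_nonneg_nonneg basis_sum_nonneg[OF assms(1) y])
  have "1 \<le> min j (card S - j)" using j by linarith
  then have "1 \<le> real (min j (card S - j))" by linarith
  then have "1 + 1 / real (min j (card S - j)) \<le> 2" using frac_le[of 1 1 1] by fastforce
  then have "(1 + 1 / real (min j (card S - j))) * P \<le> 2 * P"
    using \<open>0 \<le> P\<close> by (rule mult_right_mono)
  moreover have "3 * P \<le> (basis_sum \<M> j S y)\<^sup>2"
    unfolding P_def using j by (intro basis_sum_ultra_log_concave)
  moreover have "0 < (basis_sum \<M> j S y)\<^sup>2" using nonzero by simp
  ultimately have "(1 + 1 / real (min j (card S - j))) * P < (basis_sum \<M> j S y)\<^sup>2"
    using \<open>0 \<le> P\<close> by linarith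
  then show "(1 + 1 / real (min j (card S - j))) * basis_sum \<M> (j - 1) S y * basis_sum \<M> (j + 1) S y
      < (basis_sum \<M> j S y)\<^sup>2"
    by (simp add: P_def mult.assoc)
qed

section \<open>Duality\<close>

lemma matroid_dual_dual:
  assumes "matroid E \<M>"
  shows "matroid_dual E (matroid_dual E \<M>) = \<M>"
proof -
  have "E - (E - B) = B" if "B \<in> \<M>" for B
    using matroid_basis(1)[OF assms that] by blast
  then show ?thesis by (simp add: matroid_dual_def image_image)
qed

text \<open>The complement of a basis meets \<open>S\<close> in the complementary number of
  elements, and its monomial is that of \<open>E\<close> divided by that of the basis. The bound on
  \<open>j\<close> keeps \<open>card S - j\<close> from truncating.\<close>

lemma basis_sum_dual:
  assumes M: "matroid E \<M>" and y: "\<forall>e\<in>E. 0 < y e" and S: "S \<subseteq> E" and j: "j \<le> card S"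
  shows "basis_sum (matroid_dual E \<M>) j S y
    = (\<Prod>e\<in>E. y e) * basis_sum \<M> (card S - j) S (\<lambda>e. inverse (y e))"
proof -
  have finE: "finite E" using M by (simp add: matroid_def)
  have finS: "finite S" using finite_subset[OF S finE] .
  have card: "card ((E - B) \<inter> S) = j \<longleftrightarrow> card (B \<inter> S) = card S - j" if "B \<in> \<M>" for B
  proof -
    have "(E - B) \<inter> S = S - (B \<inter> S)" using S by blast
    then have "card ((E - B) \<inter> S) = card S - card (B \<inter> S)"
      using finS by (simp add: card_Diff_subset)
    moreover have "card (B \<inter> S) \<le> card S" using finS by (intro card_mono) auto
    ultimately show ?thesis using j by linarith
  qed
  have prod: "(\<Prod>e\<in>E - B. y e) = (\<Prod>e\<in>E. y e) * (\<Prod>e\<in>B. inverse (y e))" if "B \<in> \<M>" for B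
  proof -
    have sub: "B \<subseteq> E" "finite B" using matroid_basis[OF M that] by auto
    then have "(\<Prod>e\<in>B. y e) \<noteq> 0" using y by force
    moreover have "(\<Prod>e\<in>B. inverse (y e)) = inverse (\<Prod>e\<in>B. y e)"
      using prod_inversef[of y B] by (simp add: o_def)
    ultimately show ?thesis
      using prod.subset_diff[OF sub(1) finE, of y] by simp
  qed
  have inj: "inj_on (\<lambda>B. E - B) \<M>"
  proof (rule inj_onI)
    fix A B
    assume "A \<in> \<M>" "B \<in> \<M>" "E - A = E - B"
    then show "A = B" using matroid_basis(1)[OF M] by blast
  qed
  have "{B \<in> matroid_dual E \<M>. card (B \<inter> S) = j}
      = (\<lambda>B. E - B) ` {B \<in> \<M>. card (B \<inter> S) = card S - j}"
    using card by (auto simp: matroid_dual_def)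
  then have "basis_sum (matroid_dual E \<M>) j S y
      = (\<Sum>B | B \<in> \<M> \<and> card (B \<inter> S) = card S - j. \<Prod>e\<in>E - B. y e)"
    unfolding basis_sum_def by (simp only: sum.reindex[OF inj_on_subset[OF inj Collect_subset]] o_def)
  then show ?thesis
    unfolding basis_sum_def sum_distrib_left by (simp add: prod)
qed

text \<open>Passing from \<open>j\<close> to \<open>k = card S - j\<close> swaps the two outer basis
  sums and leaves the minimum unchanged; with inverted weights both sides gain the same factor
  \<open>Y\<^sup>2\<close>.\<close>

lemma sqrt_BLC_dual:
  assumes M: "matroid E \<M>" and BLC: "sqrt_BLC E \<M>"
  shows "sqrt_BLC E (matroid_dual E \<M>)"
  unfolding sqrt_BLC_def
proof (intro allI impI)
  fix y :: "'a \<Rightarrow> real" and S j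
  assume y: "\<forall>e\<in>E. 0 < y e" and S: "S \<subseteq> E" and j: "1 \<le> j" "j \<le> card S - 1"
    and nonzero: "basis_sum (matroid_dual E \<M>) j S y \<noteq> 0"
  define Y where "Y = (\<Prod>e\<in>E. y e)"
  define k where "k = card S - j"
  define m where "m i = basis_sum \<M> i S (\<lambda>e. inverse (y e))" for i
  have "0 < Y" unfolding Y_def using y by (intro prod_pos) auto
  have k: "1 \<le> k" "k \<le> card S - 1" "card S - k = j"
    "card S - (j - 1) = k + 1" "card S - (j + 1) = k - 1"
    using j by (auto simp: k_def)
  have le: "j - 1 \<le> card S" "j \<le> card S" "j + 1 \<le> card S"
    using j by auto
  have dual: "basis_sum (matroid_dual E \<M>) (j - 1) S y = Y * m (k + 1)"
    "basis_sum (matroid_dual E \<M>) j S y = Y * m k"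
    "basis_sum (matroid_dual E \<M>) (j + 1) S y = Y * m (k - 1)"
    unfolding Y_def m_def basis_sum_dual[OF M y S le(1)] basis_sum_dual[OF M y S le(2)]
      basis_sum_dual[OF M y S le(3)] k(4,5) k_def[symmetric] by (rule refl)+
  have "(1 + 1 / real (min k j)) * m (k - 1) * m (k + 1) < (m k)\<^sup>2"
    using BLC k S y nonzero unfolding sqrt_BLC_def dual m_def by auto
  then have "Y\<^sup>2 * ((1 + 1 / real (min k j)) * m (k - 1) * m (k + 1)) < Y\<^sup>2 * (m k)\<^sup>2"
    using \<open>0 < Y\<close> by (intro mult_strict_left_mono) auto
  then show "(1 + 1 / real (min j (card S - j))) * basis_sum (matroid_dual E \<M>) (j - 1) S y
      * basis_sum (matroid_dual E \<M>) (j + 1) S y < (basis_sum (matroid_dual E \<M>) j S y)\<^sup>2"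
    unfolding dual k_def[symmetric] min.commute[of j]
    by (simp add: power_mult_distrib power2_eq_square mult_ac)
qed

theorem theorem5p2:
  fixes E :: "'a set" and \<M> :: "'a set set"
  assumes "matroid E \<M>"
    and "matroid_rank \<M> = 3 \<or> matroid_rank (matroid_dual E \<M>) = 3"
  shows "sqrt_BLC E \<M>"
  using assms(2)
proof
  assume "matroid_rank \<M> = 3"
  with assms(1) show ?thesis by (rule rank_three_sqrt_BLC)
next
  assume "matroid_rank (matroid_dual E \<M>) = 3"
  \<comment> \<open>The rank three case is applied to the dual, and dualising once more returns to
    \<open>\<M>\<close>.\<close>
  then have "sqrt_BLC E (matroid_dual E (matroid_dual E \<M>))"
    by (intro sqrt_BLC_dual rank_three_sqrt_BLC matroid_dual_matroid assms(1))
  then show ?thesis by (simp add: matroid_dual_dual[OF assms(1)])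
qed

end
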